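(* Let $I$ be an arbitrary index set and, for each $\alpha\in I$, let $X_\alpha$ be a random variable with $X_\alpha\ge 0$ and $\mathbb{E}X_\alpha<\infty$. Pick any $c\in(0,\infty)$ and for each $\alpha\in I$ let $Y_\alpha$ have the size biased distribution of $c+X_\alpha$, i.e. $Y_\alpha=(c+X_\alpha)^*$. Then $\{X_\alpha:\alpha\in I\}$ is uniformly integrable if and only if $\{Y_\alpha:\alpha\in I\}$ is tight.
   Context: For a nonnegative random variable $X$ with $a:=\mathbb{E}X\in(0,\infty)$, $X^*$ denotes a random variable with the size biased distribution of $X$: the law of $X^*$ is absolutely continuous with respect to the law of $X$ with Radon-Nikodym derivative $x/a$; equivalently $\mathbb{E}g(X^* )=\frac1a\mathbb{E}(Xg(X))$ for all bounded measurable $g$. A family of nonnegative random variables $\{Y_\alpha\}$ is tight iff for all $\varepsilon>0$ there is $L<\infty$ with $\mathbb{P}(Y_\alpha>L)<\varepsilon$ for all $\alpha$. A family of nonnegative random variables $\{X_\alpha\}$ is uniformly integrable iff for all $\delta>0$ there is $L<\infty$ with $\mathbb{E}(X_\alpha\mathbf{1}(X_\alpha>L))<\delta$ for all $\alpha$. *)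

theory Defs
  imports "HOL-Probability.Probability"
begin

text \<open>
  \<open>Y\<close> (on \<open>N\<close>) has the size biased distribution of \<open>X\<close> (on \<open>M\<close>). Meaningful when \<open>X\<close> is
  a nonnegative integrable random variable with strictly positive mean \<open>a\<close>; the density
  \<open>x / a\<close> is then nonnegative almost everywhere with respect to the law of \<open>X\<close>, so that
  \<open>ennreal\<close> truncates nothing.
\<close>

definition has_size_biased_distr ::
    "'b measure \<Rightarrow> ('b \<Rightarrow> real) \<Rightarrow> 'a measure \<Rightarrow> ('a \<Rightarrow> real) \<Rightarrow> bool" where
  "has_size_biased_distr N Y M X \<longleftrightarrow>
     distr N borel Y = density (distr M borel X) (\<lambda>x. ennreal (x / (\<integral>\<omega>. X \<omega> \<partial>M)))"

text \<open>
  The following two notions are for families of nonnegative random variables, each member of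
  which may live on its own probability space. The library's \<open>tight\<close> only covers
  sequences of distributions. The expectation in \<open>uniformly_integrable_family\<close> is the
  nonnegative integral, so it is infinite, rather than \<open>0\<close>, when \<open>X i\<close> is not integrable.
\<close>

definition tight_family :: "'i set \<Rightarrow> ('i \<Rightarrow> 'a measure) \<Rightarrow> ('i \<Rightarrow> 'a \<Rightarrow> real) \<Rightarrow> bool" where
  "tight_family I M Y \<longleftrightarrow>
     (\<forall>\<epsilon>>0. \<exists>L::real. \<forall>i\<in>I. measure (M i) {\<omega> \<in> space (M i). Y i \<omega> > L} < \<epsilon>)"

definition uniformly_integrable_family ::
    "'i set \<Rightarrow> ('i \<Rightarrow> 'a measure) \<Rightarrow> ('i \<Rightarrow> 'a \<Rightarrow> real) \<Rightarrow> bool" where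
  "uniformly_integrable_family I M X \<longleftrightarrow>
     (\<forall>\<delta>>0. \<exists>L::real. \<forall>i\<in>I.
        (\<integral>\<^sup>+\<omega>. ennreal (X i \<omega> * indicator {x. x > L} (X i \<omega>)) \<partial>M i) < ennreal \<delta>)"

end

theory Submission
  imports Defs
begin

text \<open>
  Put \<open>Z = c + X\<close> and let \<open>a = c + \<bbbE> X\<close> be its mean. Size biasing turns the tails of \<open>Y\<close> into
  truncated expectations, \<open>P (Y > t) = \<bbbE> (Z; Z > t) / a\<close>
  (lemma \<open>size_biased_measure_eq\<close>), so the theorem compares \<open>\<bbbE> (X; X > L)\<close> with
  \<open>P (Y > c + L) = \<bbbE> (c + X; X > L) / a\<close>. In both directions the point is to control the factor
  \<open>a\<close> and the summand \<open>c\<close> uniformly over the family.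

  If the family \<open>X\<close> is uniformly integrable, the shift by \<open>c\<close> gives \<open>a \<ge> c\<close>, and for \<open>L \<ge> c\<close> the
  summand \<open>c\<close> is dominated by \<open>X\<close> on \<open>{X > L}\<close>; hence
  \<open>P (Y > c + L) \<le> 2 * \<bbbE> (X; X > L) / c\<close>. (Without the shift the means
  could approach \<open>0\<close> and tightness could fail: if \<open>X\<^sub>n\<close> equals \<open>n\<close> with probability \<open>1 / n\<^sup>2\<close> and
  \<open>0\<close> otherwise, its size biased version is constantly \<open>n\<close>.)

  Conversely \<open>\<bbbE> (X; X > L) \<le> a * P (Y > c + L)\<close>, which is useful only if the means are bounded.
  Tightness provides this: once \<open>P (Y > L) < 1/2\<close>, at least half of the mean of \<open>Z\<close> comes from
  \<open>{Z \<le> L}\<close>, where \<open>Z\<close> contributes at most \<open>L\<close>, so that \<open>a \<le> 2 * L\<close>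
  (lemma \<open>size_biased_mean_bound\<close>).
\<close>

text \<open>
  This is the defining property \<open>\<bbbE> g(Z\<^sup>*) = \<bbbE> (Z g(Z)) / \<bbbE> Z\<close> for indicator functions \<open>g\<close>; the
  sign condition on \<open>Z\<close> lets the nonnegative integral of the density be read as a real one.
\<close>

lemma size_biased_measure_eq:
  fixes Z :: "'a \<Rightarrow> real" and Y :: "'b \<Rightarrow> real"
  assumes Y: "Y \<in> borel_measurable N"
    and Z: "integrable M Z" "AE \<omega> in M. 0 \<le> Z \<omega>"
    and sb: "has_size_biased_distr N Y M Z"
    and A: "A \<in> sets borel"
  shows "measure N {\<omega> \<in> space N. Y \<omega> \<in> A} =
           (\<integral>\<omega>. Z \<omega> * indicator A (Z \<omega>) \<partial>M) / (\<integral>\<omega>. Z \<omega> \<partial>M)"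
proof -
  define a where "a = (\<integral>\<omega>. Z \<omega> \<partial>M)"
  have a0: "0 \<le> a" unfolding a_def using Z(2) by (rule integral_nonneg_AE)
  have Zm[measurable]: "Z \<in> borel_measurable M" using Z(1) by auto
  note A[measurable] Y[measurable]
  have int: "integrable M (\<lambda>\<omega>. Z \<omega> * indicator A (Z \<omega>))"
    by (rule Bochner_Integration.integrable_bound[OF Z(1)]) (auto simp: indicator_def)
  have "emeasure N {\<omega> \<in> space N. Y \<omega> \<in> A} = emeasure (distr N borel Y) A"
    by (subst emeasure_distr) (auto intro!: arg_cong[where f = "emeasure N"])
  also have "\<dots> = (\<integral>\<^sup>+x. ennreal (x / a) * indicator A x \<partial>distr M borel Z)"
    using sb by (simp add: has_size_biased_distr_def a_def emeasure_density)
  also have "\<dots> = (\<integral>\<^sup>+\<omega>. ennreal (Z \<omega> / a) * indicator A (Z \<omega>) \<partial>M)"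
    by (simp add: nn_integral_distr)
  also have "\<dots> = (\<integral>\<^sup>+\<omega>. ennreal (Z \<omega> * indicator A (Z \<omega>) / a) \<partial>M)"
    by (intro nn_integral_cong) (auto simp: indicator_def)
  also have "\<dots> = ennreal (\<integral>\<omega>. Z \<omega> * indicator A (Z \<omega>) / a \<partial>M)"
    using int Z(2) a0 by (intro nn_integral_eq_integral) auto
  finally have "emeasure N {\<omega> \<in> space N. Y \<omega> \<in> A} =
    ennreal ((\<integral>\<omega>. Z \<omega> * indicator A (Z \<omega>) \<partial>M) / a)" by simp
  moreover have "0 \<le> (\<integral>\<omega>. Z \<omega> * indicator A (Z \<omega>) \<partial>M) / a"
    using Z(2) a0 by (intro divide_nonneg_nonneg integral_nonneg_AE) auto
  ultimately show ?thesis by (simp add: measure_def a_def)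
qed

text \<open>
  A large mean pushes the size biased variable upwards: \<open>P (Y \<le> L) = \<bbbE> (Z; Z \<le> L) / \<bbbE> Z\<close> is at
  most \<open>L / \<bbbE> Z\<close>. So a bound on the tail of \<open>Y\<close> bounds the mean of \<open>Z\<close>.
\<close>

lemma size_biased_mean_bound:
  fixes Z :: "'a \<Rightarrow> real" and Y :: "'b \<Rightarrow> real"
  assumes M: "prob_space M" and N: "prob_space N"
    and Y: "Y \<in> borel_measurable N"
    and Z: "integrable M Z" "AE \<omega> in M. 0 \<le> Z \<omega>"
    and pos: "0 < (\<integral>\<omega>. Z \<omega> \<partial>M)"
    and sb: "has_size_biased_distr N Y M Z"
    and tail: "measure N {\<omega> \<in> space N. Y \<omega> > L} < 1 / 2"
    and L: "0 \<le> L"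
  shows "(\<integral>\<omega>. Z \<omega> \<partial>M) \<le> 2 * L"
proof -
  interpret M: prob_space M by fact
  interpret N: prob_space N by fact
  note Y[measurable]
  have [measurable]: "Z \<in> borel_measurable M" using Z(1) by auto
  have "{\<omega> \<in> space N. Y \<omega> \<in> {..L}} = space N - {\<omega> \<in> space N. Y \<omega> > L}" by auto
  then have "measure N {\<omega> \<in> space N. Y \<omega> \<in> {..L}} = 1 - measure N {\<omega> \<in> space N. Y \<omega> > L}"
    by (simp add: N.prob_compl)
  then have "1 / 2 \<le> measure N {\<omega> \<in> space N. Y \<omega> \<in> {..L}}"
    using tail by simp
  also have "\<dots> = (\<integral>\<omega>. Z \<omega> * indicator {..L} (Z \<omega>) \<partial>M) / (\<integral>\<omega>. Z \<omega> \<partial>M)"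
    by (rule size_biased_measure_eq[OF Y Z sb]) simp
  also have "\<dots> \<le> L / (\<integral>\<omega>. Z \<omega> \<partial>M)"
  proof (intro divide_right_mono)
    have "integrable M (\<lambda>\<omega>. Z \<omega> * indicator {..L} (Z \<omega>))"
      by (rule Bochner_Integration.integrable_bound[OF Z(1)]) (auto simp: indicator_def)
    then have "(\<integral>\<omega>. Z \<omega> * indicator {..L} (Z \<omega>) \<partial>M) \<le> (\<integral>\<omega>. L \<partial>M)"
      using L by (intro integral_mono) (auto simp: indicator_def)
    then show "(\<integral>\<omega>. Z \<omega> * indicator {..L} (Z \<omega>) \<partial>M) \<le> L"
      by (simp add: M.prob_space)
  qed (use pos in simp)
  finally show ?thesis using pos by (simp add: field_simps)
qed

text \<open>
  One has \<open>X \<le> c + X\<close> everywhere and \<open>c + X \<le> 2 * X\<close> on \<open>{X > L}\<close> as soon as \<open>L \<ge> c\<close>. These two bounds transfer smallness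
  between the tails of \<open>Y\<close> and the truncated expectations of \<open>X\<close>, one in each direction.
\<close>

lemma size_biased_shift_tail:
  fixes X :: "'a \<Rightarrow> real" and Y :: "'b \<Rightarrow> real"
  assumes M: "prob_space M"
    and Y: "Y \<in> borel_measurable N"
    and X: "integrable M X" "AE \<omega> in M. 0 \<le> X \<omega>"
    and c: "0 < c"
    and sb: "has_size_biased_distr N Y M (\<lambda>\<omega>. c + X \<omega>)"
  shows size_biased_shift_tail_lower:
      "(\<integral>\<omega>. X \<omega> * indicator {x. x > L} (X \<omega>) \<partial>M)
         \<le> (\<integral>\<omega>. c + X \<omega> \<partial>M) * measure N {\<omega> \<in> space N. Y \<omega> > c + L}"
    and size_biased_shift_tail_upper:
      "c \<le> L \<Longrightarrow> measure N {\<omega> \<in> space N. Y \<omega> > c + L}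
         \<le> 2 * (\<integral>\<omega>. X \<omega> * indicator {x. x > L} (X \<omega>) \<partial>M) / c"
proof -
  interpret M: prob_space M by fact
  have [measurable]: "X \<in> borel_measurable M" using X(1) by auto
  define a where "a = (\<integral>\<omega>. c + X \<omega> \<partial>M)"
  define T where "T = (\<integral>\<omega>. (c + X \<omega>) * indicator {x. x > L} (X \<omega>) \<partial>M)"
  have "0 \<le> (\<integral>\<omega>. X \<omega> \<partial>M)" using X(2) by (rule integral_nonneg_AE)
  then have ac: "c \<le> a" using X(1) by (simp add: a_def M.prob_space)
  have "measure N {\<omega> \<in> space N. Y \<omega> \<in> {c + L<..}} =
      (\<integral>\<omega>. (c + X \<omega>) * indicator {c + L<..} (c + X \<omega>) \<partial>M) / a"
    unfolding a_def by (rule size_biased_measure_eq) (use Y X c sb in auto)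
  moreover have "indicator {c + L<..} (c + X \<omega>) = (indicator {x. x > L} (X \<omega>) :: real)" for \<omega>
    by (simp add: indicator_def)
  ultimately have tail: "measure N {\<omega> \<in> space N. Y \<omega> > c + L} = T / a"
    by (simp add: T_def)
  have intX: "integrable M (\<lambda>\<omega>. X \<omega> * indicator {x. x > L} (X \<omega>))"
    by (rule Bochner_Integration.integrable_bound[OF X(1)]) (auto simp: indicator_def)
  have "integrable M (\<lambda>\<omega>. c + X \<omega>)" using X(1) by simp
  then have intT: "integrable M (\<lambda>\<omega>. (c + X \<omega>) * indicator {x. x > L} (X \<omega>))"
    by (rule Bochner_Integration.integrable_bound) (auto simp: indicator_def)
  have "(\<integral>\<omega>. X \<omega> * indicator {x. x > L} (X \<omega>) \<partial>M) \<le> T"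
    unfolding T_def using c by (intro integral_mono intX intT) (auto simp: indicator_def)
  then show "(\<integral>\<omega>. X \<omega> * indicator {x. x > L} (X \<omega>) \<partial>M)
      \<le> (\<integral>\<omega>. c + X \<omega> \<partial>M) * measure N {\<omega> \<in> space N. Y \<omega> > c + L}"
    using ac c by (simp add: tail flip: a_def)
  show "measure N {\<omega> \<in> space N. Y \<omega> > c + L}
      \<le> 2 * (\<integral>\<omega>. X \<omega> * indicator {x. x > L} (X \<omega>) \<partial>M) / c" if "c \<le> L"
  proof -
    have "T \<le> (\<integral>\<omega>. 2 * (X \<omega> * indicator {x. x > L} (X \<omega>)) \<partial>M)"
      unfolding T_def using that
      by (intro integral_mono intT integrable_mult_right intX) (auto simp: indicator_def)
    then have T2: "T \<le> 2 * (\<integral>\<omega>. X \<omega> * indicator {x. x > L} (X \<omega>) \<partial>M)" by simp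
    have "0 \<le> T" unfolding T_def using X(2) c
      by (intro integral_nonneg_AE) (auto simp: indicator_def)
    then have "T / a \<le> T / c" using ac c by (intro divide_left_mono) auto
    also have "\<dots> \<le> 2 * (\<integral>\<omega>. X \<omega> * indicator {x. x > L} (X \<omega>) \<partial>M) / c"
      using T2 c by (intro divide_right_mono) auto
    finally show ?thesis by (simp add: tail)
  qed
qed

theorem theorem8p2:
  fixes I :: "'i set"
    and M :: "'i \<Rightarrow> 'a measure" and X :: "'i \<Rightarrow> 'a \<Rightarrow> real"
    and N :: "'i \<Rightarrow> 'b measure" and Y :: "'i \<Rightarrow> 'b \<Rightarrow> real"
    and c :: real
  assumes "\<And>\<alpha>. \<alpha> \<in> I \<Longrightarrow> prob_space (M \<alpha>)"
    and "\<And>\<alpha>. \<alpha> \<in> I \<Longrightarrow> X \<alpha> \<in> borel_measurable (M \<alpha>)"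
    and "\<And>\<alpha>. \<alpha> \<in> I \<Longrightarrow> AE \<omega> in M \<alpha>. 0 \<le> X \<alpha> \<omega>"
    and "\<And>\<alpha>. \<alpha> \<in> I \<Longrightarrow> integrable (M \<alpha>) (X \<alpha>)"
    and "0 < c"
    and "\<And>\<alpha>. \<alpha> \<in> I \<Longrightarrow> prob_space (N \<alpha>)"
    and "\<And>\<alpha>. \<alpha> \<in> I \<Longrightarrow> Y \<alpha> \<in> borel_measurable (N \<alpha>)"
    and "\<And>\<alpha>. \<alpha> \<in> I \<Longrightarrow> has_size_biased_distr (N \<alpha>) (Y \<alpha>) (M \<alpha>) (\<lambda>\<omega>. c + X \<alpha> \<omega>)"
  shows "uniformly_integrable_family I M X \<longleftrightarrow> tight_family I N Y"
proof -
  define U where "U \<alpha> L = (\<integral>\<omega>. X \<alpha> \<omega> * indicator {x. x > L} (X \<alpha> \<omega>) \<partial>M \<alpha>)" for \<alpha> L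
  have U: "(\<integral>\<^sup>+\<omega>. ennreal (X \<alpha> \<omega> * indicator {x. x > L} (X \<alpha> \<omega>)) \<partial>M \<alpha>) = ennreal (U \<alpha> L)"
    if "\<alpha> \<in> I" for \<alpha> L
  proof -
    note assms(2)[OF that, measurable]
    have "integrable (M \<alpha>) (\<lambda>\<omega>. X \<alpha> \<omega> * indicator {x. x > L} (X \<alpha> \<omega>))"
      by (rule Bochner_Integration.integrable_bound[OF assms(4)[OF that]]) (auto simp: indicator_def)
    then show ?thesis
      unfolding U_def using assms(3)[OF that] by (intro nn_integral_eq_integral) auto
  qed
  have UI: "uniformly_integrable_family I M X \<longleftrightarrow> (\<forall>\<delta>>0. \<exists>L. \<forall>\<alpha>\<in>I. U \<alpha> L < \<delta>)"
    unfolding uniformly_integrable_family_def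
    by (intro all_cong ex_cong1 ball_cong) (use ennreal_leI ennreal_lessI not_le U in metis)+
  have U_mono: "U \<alpha> L' \<le> U \<alpha> L" if "\<alpha> \<in> I" "L \<le> L'" for \<alpha> L L'
  proof -
    note assms(2)[OF that(1), measurable]
    have "integrable (M \<alpha>) (\<lambda>\<omega>. X \<alpha> \<omega> * indicator {x. x > t} (X \<alpha> \<omega>))" for t
      by (rule Bochner_Integration.integrable_bound[OF assms(4)[OF that(1)]])
        (auto simp: indicator_def)
    then show ?thesis
      unfolding U_def using assms(3)[OF that(1)] that(2)
      by (intro integral_mono_AE) (auto simp: indicator_def)
  qed
  have N_mono: "measure (N \<alpha>) {\<omega> \<in> space (N \<alpha>). Y \<alpha> \<omega> > L'}
      \<le> measure (N \<alpha>) {\<omega> \<in> space (N \<alpha>). Y \<alpha> \<omega> > L}" if "\<alpha> \<in> I" "L \<le> L'" for \<alpha> L L'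
  proof -
    interpret prob_space "N \<alpha>" using assms(6)[OF that(1)] .
    note assms(7)[OF that(1), measurable]
    show ?thesis using that(2) by (intro finite_measure_mono) auto
  qed
  note lower = size_biased_shift_tail_lower
    [OF assms(1) assms(7) assms(4) assms(3) assms(5) assms(8), folded U_def]
  note upper = size_biased_shift_tail_upper
    [OF assms(1) assms(7) assms(4) assms(3) assms(5) assms(8), folded U_def]
  show ?thesis
  proof
    assume ui: "uniformly_integrable_family I M X"
    show "tight_family I N Y"
      unfolding tight_family_def
    proof (intro allI impI)
      fix \<epsilon> :: real assume "\<epsilon> > 0"
      then have "\<epsilon> * c / 2 > 0" using assms(5) by simp
      then obtain L where L: "\<forall>\<alpha>\<in>I. U \<alpha> L < \<epsilon> * c / 2" using ui UI by blast
      have "measure (N \<alpha>) {\<omega> \<in> space (N \<alpha>). Y \<alpha> \<omega> > c + max L c} < \<epsilon>" if "\<alpha> \<in> I" for \<alpha>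
      proof -
        have "measure (N \<alpha>) {\<omega> \<in> space (N \<alpha>). Y \<alpha> \<omega> > c + max L c} \<le> 2 * U \<alpha> (max L c) / c"
          by (rule upper) (use that in auto)
        also have "\<dots> \<le> 2 * U \<alpha> L / c"
          using U_mono[OF that, of L "max L c"] assms(5) by (simp add: divide_right_mono)
        also have "\<dots> < \<epsilon>"
          using L that assms(5) by (simp add: field_simps)
        finally show ?thesis .
      qed
      then show "\<exists>L. \<forall>\<alpha>\<in>I. measure (N \<alpha>) {\<omega> \<in> space (N \<alpha>). Y \<alpha> \<omega> > L} < \<epsilon>" by blast
    qed
  next
    assume tight: "tight_family I N Y"
    have "\<exists>L. \<forall>\<alpha>\<in>I. measure (N \<alpha>) {\<omega> \<in> space (N \<alpha>). Y \<alpha> \<omega> > L} < 1 / 2"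
      using tight[unfolded tight_family_def, rule_format, of "1 / 2"] by simp
    then obtain L0 where L0: "\<forall>\<alpha>\<in>I. measure (N \<alpha>) {\<omega> \<in> space (N \<alpha>). Y \<alpha> \<omega> > L0} < 1 / 2" ..
    \<comment> \<open>If \<open>I\<close> is empty, \<open>L0\<close> may be negative; the maximum keeps \<open>B\<close> positive in this case too.\<close>
    define B where "B = 2 * max L0 1"
    have B: "0 < B" by (simp add: B_def)
    have mean: "(\<integral>\<omega>. c + X \<alpha> \<omega> \<partial>M \<alpha>) \<le> B" if "\<alpha> \<in> I" for \<alpha>
      unfolding B_def
    proof (rule size_biased_mean_bound[OF assms(1,6,7)[OF that] _ _ _ assms(8)[OF that]])
      interpret prob_space "M \<alpha>" using assms(1)[OF that] .
      show "integrable (M \<alpha>) (\<lambda>\<omega>. c + X \<alpha> \<omega>)" using assms(4)[OF that] by simp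
      show "AE \<omega> in M \<alpha>. 0 \<le> c + X \<alpha> \<omega>" using assms(3)[OF that] assms(5) by auto
      have "0 \<le> (\<integral>\<omega>. X \<alpha> \<omega> \<partial>M \<alpha>)" using assms(3)[OF that] by (rule integral_nonneg_AE)
      then show "0 < (\<integral>\<omega>. c + X \<alpha> \<omega> \<partial>M \<alpha>)"
        using assms(4)[OF that] assms(5) by (simp add: prob_space)
      show "measure (N \<alpha>) {\<omega> \<in> space (N \<alpha>). Y \<alpha> \<omega> > max L0 1} < 1 / 2"
        using N_mono[OF that, of L0 "max L0 1"] L0 that by fastforce
    qed simp
    show "uniformly_integrable_family I M X"
      unfolding UI
    proof (intro allI impI)
      fix \<delta> :: real assume "\<delta> > 0"
      then have "\<delta> / B > 0" using B by simp
      then obtain L where L: "\<forall>\<alpha>\<in>I. measure (N \<alpha>) {\<omega> \<in> space (N \<alpha>). Y \<alpha> \<omega> > L} < \<delta> / B"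
        using tight[unfolded tight_family_def] by blast
      have "U \<alpha> (L - c) < \<delta>" if "\<alpha> \<in> I" for \<alpha>
      proof -
        have "U \<alpha> (L - c) \<le> (\<integral>\<omega>. c + X \<alpha> \<omega> \<partial>M \<alpha>) * measure (N \<alpha>) {\<omega> \<in> space (N \<alpha>). Y \<alpha> \<omega> > L}"
          using lower[OF that that that that that, of "L - c"] by simp
        also have "\<dots> \<le> B * measure (N \<alpha>) {\<omega> \<in> space (N \<alpha>). Y \<alpha> \<omega> > L}"
          using mean[OF that] by (intro mult_right_mono) auto
        also have "\<dots> < \<delta>"
          using L that B by (simp add: field_simps)
        finally show ?thesis .
      qed
      then show "\<exists>L. \<forall>\<alpha>\<in>I. U \<alpha> L < \<delta>" by blast
    qed
  qed
qed

end
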